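(* Let $N^{H_1,H_2}(a,b)=\{N_t^{H_1,H_2}(a,b),\,t\ge 0\}$ be a generalized mixed fractional Brownian motion with $0<H_1<H_2<1$ and $a,b\in\mathbb{R}$ not both zero. Let $\Gamma=\{\Gamma_t,\,t\ge0\}$ be the Gamma process with parameter $\nu>0$, independent of the two fractional Brownian motions $B^{H_1},B^{H_2}$ defining $N^{H_1,H_2}(a,b)$. If $2H_1-H_2<1$, then the time-changed process $\{N^{H_1,H_2}_{\Gamma_t}(a,b),\,t\ge 0\}$ has the long-range dependence property.
   Context: Fractional Brownian motion $B^H=\{B^H_t,t\ge0\}$ with Hurst parameter $H\in(0,1)$ is the Gaussian process with continuous sample paths such that $B^H_0=0$, $E(B^H_t)=0$ and $E(B^H_sB^H_t)=\frac12[s^{2H}+t^{2H}-|s-t|^{2H}]$ for $s,t\ge0$. Generalized mixed fractional Brownian motion with Hurst indices $H_1,H_2\in(0,1)$: $N_t^{H_1,H_2}(a,b)=aB_t^{H_1}+bB_t^{H_2}$, $t\ge0$, where $B^{H_1}$ and $B^{H_2}$ are independent fractional Brownian motions and $a,b\in\mathbb{R}$ are not both zero. Gamma process with parameter $\nu>0$: the process $\Gamma=\{\Gamma_t,t\ge0\}$, with $\Gamma_0=0$, having stationary independent increments such that the increment $\Gamma_{t+s}-\Gamma_s$ has the Gamma distribution with probability density function $$f(x,t)=\frac{1}{\Gamma(t/\nu)}x^{(t/\nu)-1}e^{-x}\ \text{ for } x>0,\qquad f(x,t)=0\ \text{ for } x\le0,$$ where $\Gamma(\cdot)$ in the denominator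 is the Gamma function. Long-range dependence: let $\{X_t,t\ge0\}$ be a stochastic process with $E(X_t^2)<\infty$ for all $t\ge0$. It is said to be long-range dependent if, for any fixed $s>0$ (with $t>s$), $$\mathrm{Corr}(X_t,X_s)\simeq c(s)t^{-d}\quad\text{as } t\to\infty$$ for some constant $c(s)$ depending only on $s$. The definition specifies no range for the exponent $d$. Here $\simeq$ denotes asymptotic equivalence as $t\to\infty$. *)

theory Defs
  imports "HOL-Probability.Probability" "HOL-Library.Landau_Symbols"
begin

text \<open>A process is a function \<open>X t \<omega>\<close> of real time; only its values at \<open>t \<ge> 0\<close>
  are ever constrained or used.\<close>

definition correlation :: "'a measure \<Rightarrow> ('a \<Rightarrow> real) \<Rightarrow> ('a \<Rightarrow> real) \<Rightarrow> real" where
  "correlation M X Y =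
     (\<integral>\<omega>. (X \<omega> - integral\<^sup>L M X) * (Y \<omega> - integral\<^sup>L M Y) \<partial>M)
     / (sqrt (\<integral>\<omega>. (X \<omega> - integral\<^sup>L M X)\<^sup>2 \<partial>M) * sqrt (\<integral>\<omega>. (Y \<omega> - integral\<^sup>L M Y)\<^sup>2 \<partial>M))"

definition process_sigma_sets ::
  "'a measure \<Rightarrow> (real \<Rightarrow> 'a \<Rightarrow> 'b::topological_space) \<Rightarrow> 'a set set" where
  "process_sigma_sets M X = sigma_sets (space M) {X t -` A \<inter> space M |t A. 0 \<le> t \<and> A \<in> sets borel}"

definition indep_processes ::
  "'a measure \<Rightarrow> (real \<Rightarrow> 'a \<Rightarrow> 'b::topological_space) \<Rightarrow> (real \<Rightarrow> 'a \<Rightarrow> 'c::topological_space) \<Rightarrow> bool" where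
  "indep_processes M X Y \<longleftrightarrow>
     prob_space.indep_set M (process_sigma_sets M X) (process_sigma_sets M Y)"

text \<open>Almost surely constant variables count as (degenerate) Gaussian variables.\<close>

definition gaussian_variable :: "'a measure \<Rightarrow> ('a \<Rightarrow> real) \<Rightarrow> bool" where
  "gaussian_variable M X \<longleftrightarrow> X \<in> borel_measurable M \<and>
     ((\<exists>\<mu> \<sigma>. 0 < \<sigma> \<and> distributed M lborel X (\<lambda>x. ennreal (normal_density \<mu> \<sigma> x))) \<or>
      (\<exists>\<mu>. AE \<omega> in M. X \<omega> = \<mu>))"

text \<open>Joint normality of the finite-dimensional distributions, stated as normality of all
  finite linear combinations.\<close>

definition gaussian_process :: "'a measure \<Rightarrow> (real \<Rightarrow> 'a \<Rightarrow> real) \<Rightarrow> bool" where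
  "gaussian_process M X \<longleftrightarrow>
     (\<forall>I c. finite I \<longrightarrow> I \<subseteq> {0..} \<longrightarrow> gaussian_variable M (\<lambda>\<omega>. \<Sum>t\<in>I. c t * X t \<omega>))"

definition fractional_brownian_motion ::
  "'a measure \<Rightarrow> real \<Rightarrow> (real \<Rightarrow> 'a \<Rightarrow> real) \<Rightarrow> bool" where
  "fractional_brownian_motion M H B \<longleftrightarrow>
     0 < H \<and> H < 1 \<and>
     gaussian_process M B \<and>
     (\<forall>\<omega>\<in>space M. continuous_on {0..} (\<lambda>t. B t \<omega>)) \<and>
     (AE \<omega> in M. B 0 \<omega> = 0) \<and>
     (\<forall>t\<ge>0. (\<integral>\<omega>. B t \<omega> \<partial>M) = 0) \<and>
     (\<forall>s\<ge>0. \<forall>t\<ge>0. (\<integral>\<omega>. B s \<omega> * B t \<omega> \<partial>M) =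
        (s powr (2 * H) + t powr (2 * H) - \<bar>s - t\<bar> powr (2 * H)) / 2)"

definition mixed_process ::
  "real \<Rightarrow> real \<Rightarrow> (real \<Rightarrow> 'a \<Rightarrow> real) \<Rightarrow> (real \<Rightarrow> 'a \<Rightarrow> real) \<Rightarrow> real \<Rightarrow> 'a \<Rightarrow> real" where
  "mixed_process a b B1 B2 t \<omega> = a * B1 t \<omega> + b * B2 t \<omega>"

definition generalized_mixed_fbm ::
  "'a measure \<Rightarrow> real \<Rightarrow> real \<Rightarrow> real \<Rightarrow> real \<Rightarrow>
   (real \<Rightarrow> 'a \<Rightarrow> real) \<Rightarrow> (real \<Rightarrow> 'a \<Rightarrow> real) \<Rightarrow> (real \<Rightarrow> 'a \<Rightarrow> real) \<Rightarrow> bool" where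
  "generalized_mixed_fbm M H1 H2 a b B1 B2 N \<longleftrightarrow>
     fractional_brownian_motion M H1 B1 \<and>
     fractional_brownian_motion M H2 B2 \<and>
     indep_processes M B1 B2 \<and>
     (a \<noteq> 0 \<or> b \<noteq> 0) \<and>
     N = mixed_process a b B1 B2"

definition gamma_process_density :: "real \<Rightarrow> real \<Rightarrow> real \<Rightarrow> real" where
  "gamma_process_density \<nu> t x =
     (if x > 0 then 1 / Gamma (t / \<nu>) * x powr (t / \<nu> - 1) * exp (- x) else 0)"

definition independent_increments :: "'a measure \<Rightarrow> (real \<Rightarrow> 'a \<Rightarrow> real) \<Rightarrow> bool" where
  "independent_increments M X \<longleftrightarrow>
     (\<forall>(n::nat) \<tau>. 0 \<le> \<tau> 0 \<longrightarrow> (\<forall>i<n. \<tau> i < \<tau> (Suc i)) \<longrightarrow>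
        prob_space.indep_vars M (\<lambda>_. borel) (\<lambda>i \<omega>. X (\<tau> (Suc i)) \<omega> - X (\<tau> i) \<omega>) {..<n})"

text \<open>Stationarity of the increments is contained in the last condition: the law of the
  increment over \<open>[s, s + t]\<close> does not depend on \<open>s\<close>.\<close>

definition gamma_process :: "'a measure \<Rightarrow> real \<Rightarrow> (real \<Rightarrow> 'a \<Rightarrow> real) \<Rightarrow> bool" where
  "gamma_process M \<nu> \<Gamma> \<longleftrightarrow>
     0 < \<nu> \<and>
     (\<forall>t\<ge>0. \<Gamma> t \<in> borel_measurable M) \<and>
     (AE \<omega> in M. \<Gamma> 0 \<omega> = 0) \<and>
     independent_increments M \<Gamma> \<and>
     (\<forall>s\<ge>0. \<forall>t>0. distributed M lborel (\<lambda>\<omega>. \<Gamma> (t + s) \<omega> - \<Gamma> s \<omega>)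
        (\<lambda>x. ennreal (gamma_process_density \<nu> t x)))"

text \<open>\<open>X\<close> is a process on \<open>[0, \<infinity>)\<close>. The random times used below are only almost surely
  nonnegative, so they are clamped at \<open>0\<close>; this affects nothing but a null set.\<close>

definition time_change ::
  "(real \<Rightarrow> 'a \<Rightarrow> real) \<Rightarrow> (real \<Rightarrow> 'a \<Rightarrow> real) \<Rightarrow> real \<Rightarrow> 'a \<Rightarrow> real" where
  "time_change X T t \<omega> = X (max 0 (T t \<omega>)) \<omega>"

text \<open>Asymptotic equivalence means that the quotient tends to 1, which forces \<open>c s \<noteq> 0\<close>. This has
  to be said explicitly because the library relation also holds between functions that both
  vanish eventually. The exponent \<open>d\<close> does not depend on \<open>s\<close>, and its range is unrestricted.\<close>

definition long_range_dependent :: "'a measure \<Rightarrow> (real \<Rightarrow> 'a \<Rightarrow> real) \<Rightarrow> bool" where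
  "long_range_dependent M X \<longleftrightarrow>
     (\<forall>t\<ge>0. X t \<in> borel_measurable M \<and> integrable M (\<lambda>\<omega>. (X t \<omega>)\<^sup>2)) \<and>
     (\<exists>(d::real) c. \<forall>s>0. c s \<noteq> 0 \<and>
        (\<lambda>t. correlation M (X t) (X s)) \<sim>[at_top] (\<lambda>t. c s * t powr (- d)))"

end

theory Submission
  imports Defs "HOL-Real_Asymp.Real_Asymp"
begin

text \<open>Conditioning on the independent Gamma process turns the covariance of \<open>N\<close> into an expectation
  over the random times, so that with \<open>G p x = Gamma (x + p) / Gamma x\<close> (the \<open>p\<close>-th moment of a
  Gamma variable of shape \<open>x\<close>) the time-changed process has variance
  \<open>\<Sum>i. c\<^sub>i\<^sup>2 * G (2 H\<^sub>i) (t / \<nu>)\<close> and covariance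
  \<open>\<Sum>i. c\<^sub>i\<^sup>2 * (G (2 H\<^sub>i) (s / \<nu>) + G (2 H\<^sub>i) (t / \<nu>) - G (2 H\<^sub>i) ((t - s) / \<nu>)) / 2\<close>,
  where \<open>c = (a, b)\<close>.
  The mean value theorem together with the monotonicity of the digamma and trigamma functions gives
  \<open>G p x \<sim> x\<^sup>p\<close> and \<open>G p x - G p (x - h) \<sim> h p x\<^sup>p\<^sup>-\<^sup>1\<close>. Hence a single covariance term is of exact order
  \<open>t powr max 0 (p - 1)\<close>, and the correlation decays like \<open>t powr (- d)\<close> with
  \<open>d = p / 2 - max 0 (p - 1)\<close>, where \<open>p = 2 * H2\<close> if \<open>b \<noteq> 0\<close> and \<open>p = 2 * H1\<close> otherwise.\<close>

section \<open>Asymptotics of Gamma moments\<close>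

text \<open>By the functional equation, \<open>ln_Gamma\<close> increases by exactly
  \<open>ln x\<close> over \<open>[x, x + 1]\<close>. The mean value theorem therefore makes
  \<open>ln x\<close> a value of \<open>Digamma\<close> inside this interval, and monotonicity
  compares that value with the endpoints.\<close>

lemma Digamma_real_le_ln:
  assumes "x > (0::real)"
  shows "Digamma x \<le> ln x" and "ln x \<le> Digamma (x + 1)"
proof -
  have "\<exists>z. x < z \<and> z < x + 1 \<and> ln_Gamma (x + 1) - ln_Gamma x = (x + 1 - x) * Digamma z"
    by (rule MVT2) (use assms in \<open>auto intro!: derivative_eq_intros\<close>)
  then obtain z where z: "x < z" "z < x + 1" "ln_Gamma (x + 1) - ln_Gamma x = Digamma z"
    by auto
  have "ln_Gamma (x + 1) - ln_Gamma x = ln x"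
    using assms Gamma_real_pos[of x]
    by (simp add: ln_Gamma_real_pos Gamma_plus1 ln_mult_pos nonpos_Ints_def del: Gamma_real_pos)
  with z have "ln x = Digamma z" by simp
  with z assms show "Digamma x \<le> ln x" "ln x \<le> Digamma (x + 1)"
    using Digamma_real_mono[of x z] Digamma_real_mono[of z "x + 1"] by auto
qed

text \<open>The same argument one derivative higher: \<open>Digamma\<close> increases by
  \<open>1 / x\<close> over a unit interval, and the trigamma function \<open>Polygamma 1\<close> is
  decreasing.\<close>

lemma Trigamma_real_bounds:
  assumes "x > (0::real)"
  shows "1 / x \<le> Polygamma 1 x" and "Polygamma 1 (x + 1) \<le> 1 / x"
proof -
  have "\<exists>z. x < z \<and> z < x + 1 \<and> Digamma (x + 1) - Digamma x = (x + 1 - x) * Polygamma 1 z"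
    by (rule MVT2) (use assms in \<open>auto intro!: derivative_eq_intros elim!: nonpos_Ints_cases\<close>)
  then obtain z where z: "x < z" "z < x + 1" "Digamma (x + 1) - Digamma x = Polygamma 1 z"
    by auto
  have "Digamma (x + 1) - Digamma x = 1 / x"
    using assms by (simp add: Digamma_plus1)
  with z have "1 / x = Polygamma 1 z" by simp
  with z assms show "1 / x \<le> Polygamma 1 x" "Polygamma 1 (x + 1) \<le> 1 / x"
    using Polygamma_real_strict_antimono[of x z 1] Polygamma_real_strict_antimono[of z "x + 1" 1] 
    by auto
qed

definition Gamma_moment :: "real \<Rightarrow> real \<Rightarrow> real" where
  "Gamma_moment p x = Gamma (x + p) / Gamma x"

lemma Gamma_moment_pos: "x > 0 \<Longrightarrow> p > 0 \<Longrightarrow> Gamma_moment p x > 0"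
  by (simp add: Gamma_moment_def)

text \<open>The logarithm of the Gamma quotient is \<open>p * Digamma z\<close> for some
  \<open>z\<close> between \<open>x\<close> and \<open>x + p\<close>. The logarithmic bounds for
  \<open>Digamma\<close> then give powers after exponentiation. The lower bound for
  \<open>Digamma\<close> is applied at \<open>z - 1\<close>, which is where the shift by 1 and the
  condition \<open>x > 1\<close> come from.\<close>

lemma Gamma_moment_bounds:
  assumes x: "x > 1" and p: "p > 0"
  shows "(x - 1) powr p \<le> Gamma_moment p x" and "Gamma_moment p x \<le> (x + p) powr p"
proof -
  have "\<exists>z. x < z \<and> z < x + p \<and> ln_Gamma (x + p) - ln_Gamma x = (x + p - x) * Digamma z"
    by (rule MVT2) (use assms in \<open>auto intro!: derivative_eq_intros\<close>)
  then obtain z where z: "x < z" "z < x + p" "ln_Gamma (x + p) - ln_Gamma x = p * Digamma z"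
    by auto
  have G: "Gamma_moment p x = exp (p * Digamma z)"
    using assms by (simp add: Gamma_moment_def z(3)[symmetric] exp_diff Gamma_real_pos_exp)
  have "ln (x - 1) \<le> ln (z - 1)" using z x by simp
  also have "\<dots> \<le> Digamma z" using Digamma_real_le_ln(2)[of "z - 1"] z x by simp
  finally show "(x - 1) powr p \<le> Gamma_moment p x"
    using x p by (simp add: G powr_def)
  have "Digamma z \<le> ln z" using Digamma_real_le_ln(1)[of z] z x by simp
  also have "\<dots> \<le> ln (x + p)" using z x by simp
  finally show "Gamma_moment p x \<le> (x + p) powr p"
    using x p by (simp add: G powr_def)
qed

text \<open>The mean value theorem writes the difference as \<open>p\<close> times the trigamma
  value at some \<open>z\<close> between \<open>x\<close> and \<open>x + p\<close>, and this value
  lies between \<open>1 / z\<close> and \<open>1 / (z - 1)\<close>.\<close>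

lemma Digamma_real_diff_bounds:
  assumes x: "x > (1::real)" and p: "p > 0"
  shows "p / (x + p) \<le> Digamma (x + p) - Digamma x"
    and "Digamma (x + p) - Digamma x \<le> p / (x - 1)"
proof -
  have "\<exists>z. x < z \<and> z < x + p \<and> Digamma (x + p) - Digamma x = (x + p - x) * Polygamma 1 z"
    by (rule MVT2) (use assms in \<open>auto intro!: derivative_eq_intros elim!: nonpos_Ints_cases\<close>)
  then obtain z where z: "x < z" "z < x + p" "Digamma (x + p) - Digamma x = p * Polygamma 1 z"
    by auto
  have "1 / (x + p) \<le> 1 / z" using z x by (simp add: field_simps)
  also have "\<dots> \<le> Polygamma 1 z" using Trigamma_real_bounds(1)[of z] z x by simp
  finally show "p / (x + p) \<le> Digamma (x + p) - Digamma x"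
    using p mult_left_mono[of "1 / (x + p)" "Polygamma 1 z" p] z(3) by simp
  have "Polygamma 1 z \<le> 1 / (z - 1)" using Trigamma_real_bounds(2)[of "z - 1"] z x by simp
  also have "\<dots> \<le> 1 / (x - 1)" using z x by (simp add: field_simps)
  finally show "Digamma (x + p) - Digamma x \<le> p / (x - 1)"
    using p mult_left_mono[of "Polygamma 1 z" "1 / (x - 1)" p] z(3) by simp
qed

text \<open>Logarithmic differentiation of the Gamma quotient gives the derivative
  \<open>Gamma_moment p z * (Digamma (z + p) - Digamma z)\<close>. After the mean value theorem on
  \<open>[x - h, x]\<close>, the two factors are estimated separately, and \<open>z\<close> is
  replaced by an endpoint of the interval. The condition \<open>x > h + 1\<close> puts
  \<open>z\<close> above 1, where the earlier bounds apply.\<close>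

lemma Gamma_moment_diff_bounds:
  assumes h: "h > 0" and x: "x > h + 1" and p: "p > 0"
  shows "h * ((x - h - 1) powr p * (p / (x + p))) \<le> Gamma_moment p x - Gamma_moment p (x - h)"
    and "Gamma_moment p x - Gamma_moment p (x - h) \<le> h * ((x + p) powr p * (p / (x - h - 1)))"
proof -
  have "\<exists>z. x - h < z \<and> z < x \<and> Gamma_moment p x - Gamma_moment p (x - h) =
      (x - (x - h)) * (Gamma_moment p z * (Digamma (z + p) - Digamma z))"
  proof (rule MVT2)
    show "x - h < x" using h by simp
    fix z assume "x - h \<le> z" "z \<le> x"
    then have z: "z > 0" using x by simp
    then have "z \<notin> \<int>\<^sub>\<le>\<^sub>0" "z + p \<notin> \<int>\<^sub>\<le>\<^sub>0" "Gamma z \<noteq> 0"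
      using p Gamma_real_pos[of z] by (auto elim!: nonpos_Ints_cases simp del: Gamma_real_pos)
    then show "(Gamma_moment p has_real_derivative
        Gamma_moment p z * (Digamma (z + p) - Digamma z)) (at z)"
      unfolding Gamma_moment_def
      by (auto intro!: derivative_eq_intros simp: field_simps)
  qed
  then obtain z where z: "x - h < z" "z < x" and eq: "Gamma_moment p x - Gamma_moment p (x - h) =
      h * (Gamma_moment p z * (Digamma (z + p) - Digamma z))"
    by auto
  have z1: "z > 1" using z x by simp
  have 1: "(x - h - 1) powr p \<le> Gamma_moment p z"
    using Gamma_moment_bounds(1)[OF z1 p] powr_mono2[of p "x - h - 1" "z - 1"] z x p by simp
  have 2: "Gamma_moment p z \<le> (x + p) powr p"
    using Gamma_moment_bounds(2)[OF z1 p] powr_mono2[of p "z + p" "x + p"] z x p z1 by simp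
  have "p / (x + p) \<le> p / (z + p)"
    using z z1 p by (intro divide_left_mono) auto
  with Digamma_real_diff_bounds(1)[OF z1 p]
  have 3: "p / (x + p) \<le> Digamma (z + p) - Digamma z" by linarith
  have "p / (z - 1) \<le> p / (x - h - 1)"
    using z x p by (intro divide_left_mono) auto
  with Digamma_real_diff_bounds(2)[OF z1 p]
  have 4: "Digamma (z + p) - Digamma z \<le> p / (x - h - 1)" by linarith
  have pos: "p / (x + p) \<ge> 0" "Gamma_moment p z \<ge> 0"
    using p x h z1 Gamma_moment_pos[of z p] by auto
  show "h * ((x - h - 1) powr p * (p / (x + p))) \<le> Gamma_moment p x - Gamma_moment p (x - h)"
    unfolding eq using h 1 3 pos by (intro mult_left_mono mult_mono) auto
  show "Gamma_moment p x - Gamma_moment p (x - h) \<le> h * ((x + p) powr p * (p / (x - h - 1)))"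
    unfolding eq using h 2 3 4 pos by (intro mult_left_mono mult_mono) auto
qed

section \<open>Limits at infinity of Gamma moments and of their differences\<close>

lemma Gamma_moment_asymp:
  assumes "p > 0"
  shows "((\<lambda>x. Gamma_moment p x / x powr p) \<longlongrightarrow> 1) at_top"
proof (rule tendsto_sandwich)
  show "\<forall>\<^sub>F x in at_top. (x - 1) powr p / x powr p \<le> Gamma_moment p x / x powr p"
    using eventually_gt_at_top[of 1]
    by eventually_elim (use assms in \<open>auto intro!: divide_right_mono Gamma_moment_bounds\<close>)
  show "\<forall>\<^sub>F x in at_top. Gamma_moment p x / x powr p \<le> (x + p) powr p / x powr p"
    using eventually_gt_at_top[of 1]
    by eventually_elim (use assms in \<open>auto intro!: divide_right_mono Gamma_moment_bounds\<close>)
  show "((\<lambda>x::real. (x - 1) powr p / x powr p) \<longlongrightarrow> 1) at_top"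
    using assms by real_asymp
  show "((\<lambda>x::real. (x + p) powr p / x powr p) \<longlongrightarrow> 1) at_top"
    using assms by real_asymp
qed

lemma Gamma_moment_diff_asymp:
  assumes p: "p > 0" and h: "h > 0"
  shows "((\<lambda>x. (Gamma_moment p x - Gamma_moment p (x - h)) / x powr (p - 1)) \<longlongrightarrow> h * p) at_top"
proof (rule tendsto_sandwich)
  show "\<forall>\<^sub>F x in at_top. h * ((x - h - 1) powr p * (p / (x + p))) / x powr (p - 1)
      \<le> (Gamma_moment p x - Gamma_moment p (x - h)) / x powr (p - 1)"
    using eventually_gt_at_top[of "h + 1"]
    by eventually_elim (intro divide_right_mono Gamma_moment_diff_bounds assms, auto)
  show "\<forall>\<^sub>F x in at_top. (Gamma_moment p x - Gamma_moment p (x - h)) / x powr (p - 1)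
      \<le> h * ((x + p) powr p * (p / (x - h - 1))) / x powr (p - 1)"
    using eventually_gt_at_top[of "h + 1"]
    by eventually_elim (intro divide_right_mono Gamma_moment_diff_bounds assms, auto)
  show "((\<lambda>x. h * ((x - h - 1) powr p * (p / (x + p))) / x powr (p - 1)) \<longlongrightarrow> h * p) at_top"
    using assms by real_asymp
  show "((\<lambda>x. h * ((x + p) powr p * (p / (x - h - 1))) / x powr (p - 1)) \<longlongrightarrow> h * p) at_top"
    using assms by real_asymp
qed

text \<open>Covers leading and lower-order powers in one limit, so that sums of several powers can
  be treated term by term.\<close>

lemma powr_quotient_tendsto:
  assumes "p \<le> (q::real)"
  shows "((\<lambda>x::real. x powr p / x powr q) \<longlongrightarrow> (if p = q then 1 else 0)) at_top"
proof (cases "p = q")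
  case True
  have "\<forall>\<^sub>F x::real in at_top. 1 = x powr p / x powr q"
    using eventually_gt_at_top[of 0] by eventually_elim (simp add: True)
  then show ?thesis using True by (auto intro: tendsto_eventually elim: eventually_mono)
next
  case False
  then have "p < q" using assms by simp
  then have "((\<lambda>x::real. x powr - (q - p)) \<longlongrightarrow> 0) at_top"
    by (intro tendsto_neg_powr filterlim_ident) auto
  then show ?thesis using False by (simp add: powr_diff)
qed

text \<open>Two contributions compete: the constant \<open>Gamma_moment q h\<close>, and the
  difference of moments, which is of order \<open>x powr (q - 1)\<close>. The normalisation belongs
  to the dominant exponent \<open>p\<close>. A component with \<open>q < p\<close> may therefore
  have limit 0, whereas for \<open>q = p\<close> at least one contribution survives.\<close>

lemma Gamma_moment_covariance_asymp:
  assumes q: "q > 0" and h: "h > 0" and qp: "q \<le> p"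
  shows "\<exists>k\<ge>0. (q = p \<longrightarrow> k > 0) \<and>
    ((\<lambda>x. (Gamma_moment q h + Gamma_moment q x - Gamma_moment q (x - h)) / 2 / x powr max 0 (p - 1))
      \<longlongrightarrow> k) at_top"
proof -
  define e where "e = max 0 (p - 1)"
  \<comment> \<open>The constant survives exactly when \<open>p \<le> 1\<close>, the difference
    exactly when \<open>q = p\<close> and \<open>p \<ge> 1\<close>. At \<open>q = p = 1\<close> both
    contribute.\<close>
  define k where "k = (Gamma_moment q h * (if 0 = e then 1 else 0)
    + h * q * (if q - 1 = e then 1 else 0)) / 2"
  \<comment> \<open>Inserting \<open>x powr 0\<close> and \<open>x powr (q - 1)\<close> turns both
    terms into a convergent factor times a quotient of powers.\<close>
  have "((\<lambda>x. (Gamma_moment q h * (x powr 0 / x powr e) +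
      (Gamma_moment q x - Gamma_moment q (x - h)) / x powr (q - 1) * (x powr (q - 1) / x powr e)) / 2)
      \<longlongrightarrow> k) at_top"
    unfolding k_def using qp
    by (intro tendsto_intros powr_quotient_tendsto Gamma_moment_diff_asymp assms) (auto simp: e_def)
  moreover have "\<forall>\<^sub>F x in at_top. (Gamma_moment q h * (x powr 0 / x powr e) +
      (Gamma_moment q x - Gamma_moment q (x - h)) / x powr (q - 1) * (x powr (q - 1) / x powr e)) / 2
     = (Gamma_moment q h + Gamma_moment q x - Gamma_moment q (x - h)) / 2 / x powr e"
    using eventually_gt_at_top[of 0]
  proof eventually_elim
    case (elim x)
    then have "x powr (q - 1) > 0" by simp
    then show ?case by (simp add: field_simps)
  qed
  ultimately have "((\<lambda>x. (Gamma_moment q h + Gamma_moment q x - Gamma_moment q (x - h)) / 2 / x powr e)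
      \<longlongrightarrow> k) at_top"
    by (rule Lim_transform_eventually)
  moreover have "k \<ge> 0" "q = p \<longrightarrow> k > 0"
    using Gamma_moment_pos[OF h q] q h by (auto simp: k_def e_def max_def add_pos_pos)
  ultimately show ?thesis unfolding e_def by blast
qed

text \<open>The limit is 1 for \<open>q = p\<close> and 0 otherwise. It is stated in the same
  existential form as the limit for the covariance, so that both can enter one argument about
  weighted sums.\<close>

lemma Gamma_moment_variance_asymp:
  assumes q: "q > 0" and qp: "q \<le> p"
  shows "\<exists>k\<ge>0. (q = p \<longrightarrow> k > 0) \<and> ((\<lambda>x. Gamma_moment q x / x powr p) \<longlongrightarrow> k) at_top"
proof -
  have "((\<lambda>x. Gamma_moment q x / x powr q * (x powr q / x powr p)) \<longlongrightarrow> 1 * (if q = p then 1 else 0)) at_top"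
    using assms by (intro tendsto_intros powr_quotient_tendsto Gamma_moment_asymp)
  moreover have "\<forall>\<^sub>F x in at_top. Gamma_moment q x / x powr q * (x powr q / x powr p) = Gamma_moment q x / x powr p"
    using eventually_gt_at_top[of 0] by eventually_elim simp
  ultimately have "((\<lambda>x. Gamma_moment q x / x powr p) \<longlongrightarrow> 1 * (if q = p then 1 else 0)) at_top"
    by (rule Lim_transform_eventually)
  then show ?thesis by (intro exI[of _ "if q = p then 1 else 0"]) auto
qed

section \<open>Continuous processes and independence\<close>

text \<open>Rounding the time down to a grid leaves only countably many times, so the rounded
  process is jointly measurable. Path continuity makes it converge pointwise as the grid is
  refined.\<close>

lemma continuous_process_jointly_measurable:
  fixes X :: "real \<Rightarrow> 'a \<Rightarrow> real"
  assumes X: "\<And>t. t \<ge> 0 \<Longrightarrow> X t \<in> borel_measurable S"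
    and cont: "\<And>\<omega>. \<omega> \<in> space S \<Longrightarrow> continuous_on {0..} (\<lambda>t. X t \<omega>)"
  shows "(\<lambda>(\<omega>, u). X (max 0 u) \<omega>) \<in> borel_measurable (S \<Otimes>\<^sub>M borel)"
proof (rule borel_measurable_LIMSEQ_metric)
  \<comment> \<open>The clamped time rounded down to a multiple of \<open>1 / Suc n\<close>. It
    stays nonnegative, hence inside the domain of continuity.\<close>
  define r where "r n u = real (nat \<lfloor>max 0 u * real (Suc n)\<rfloor>) / real (Suc n)" for n :: nat and u :: real
  have r_nonneg: "r n u \<ge> 0" for n u by (simp add: r_def)
  have r_lim: "(\<lambda>n. r n u) \<longlonglongrightarrow> max 0 u" for u
  proof (rule tendsto_sandwich)
    show "\<forall>\<^sub>F n in sequentially. max 0 u - 1 / real (Suc n) \<le> r n u"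
    proof (intro always_eventually allI)
      fix n
      have "max 0 u * real (Suc n) - 1 \<le> real (nat \<lfloor>max 0 u * real (Suc n)\<rfloor>)" by linarith
      then have "(max 0 u * real (Suc n) - 1) / real (Suc n) \<le> r n u"
        unfolding r_def by (intro divide_right_mono) auto
      then show "max 0 u - 1 / real (Suc n) \<le> r n u"
        by (simp add: diff_divide_distrib)
    qed
    show "\<forall>\<^sub>F n in sequentially. r n u \<le> max 0 u"
    proof (intro always_eventually allI)
      fix n
      have "max 0 u * real (Suc n) \<ge> 0" by simp
      then have "real (nat \<lfloor>max 0 u * real (Suc n)\<rfloor>) \<le> max 0 u * real (Suc n)" by linarith
      then show "r n u \<le> max 0 u"
        unfolding r_def by (simp add: divide_le_eq)
    qed
    show "(\<lambda>n. max 0 u - 1 / real (Suc n)) \<longlonglongrightarrow> max 0 u"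
      using tendsto_diff[OF tendsto_const LIMSEQ_inverse_real_of_nat, of "max 0 u"]
      by (simp add: inverse_eq_divide)
  qed simp
  show "(\<lambda>(\<omega>, u). X (r n u) \<omega>) \<in> borel_measurable (S \<Otimes>\<^sub>M borel)" for n
  proof -
    have "(\<lambda>x. X (real (nat \<lfloor>max 0 (snd x) * real (Suc n)\<rfloor>) / real (Suc n)) (fst x))
        \<in> borel_measurable (S \<Otimes>\<^sub>M borel)"
    proof (rule measurable_compose_countable[where f="\<lambda>i x. X (real i / real (Suc n)) (fst x)"])
      show "(\<lambda>x. X (real i / real (Suc n)) (fst x)) \<in> borel_measurable (S \<Otimes>\<^sub>M borel)" for i
        by (rule measurable_compose[OF measurable_fst X]) simp
      show "(\<lambda>x. nat \<lfloor>max 0 (snd x) * real (Suc n)\<rfloor>) \<in> S \<Otimes>\<^sub>M borel \<rightarrow>\<^sub>M count_space UNIV"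
        by measurable
    qed
    then show ?thesis by (simp add: r_def case_prod_beta')
  qed
  show "(\<lambda>n. (\<lambda>(\<omega>, u). X (r n u) \<omega>) x) \<longlonglongrightarrow> (\<lambda>(\<omega>, u). X (max 0 u) \<omega>) x"
    if "x \<in> space (S \<Otimes>\<^sub>M borel)" for x
  proof -
    obtain \<omega> u where "x = (\<omega>, u)" by (cases x)
    with that have x: "x = (\<omega>, u)" "\<omega> \<in> space S" by (simp_all add: space_pair_measure)
    have "(\<lambda>n. X (r n u) \<omega>) \<longlonglongrightarrow> X (max 0 u) \<omega>"
      by (rule continuous_on_tendsto_compose[OF cont[OF x(2)] r_lim]) (auto simp: r_nonneg)
    then show ?thesis by (simp add: x)
  qed
qed

lemma time_change_measurable:
  assumes X: "\<And>t. t \<ge> 0 \<Longrightarrow> X t \<in> borel_measurable S"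
    and cont: "\<And>\<omega>. \<omega> \<in> space S \<Longrightarrow> continuous_on {0..} (\<lambda>t. X t \<omega>)"
    and T: "T t \<in> borel_measurable S"
  shows "time_change X T t \<in> borel_measurable S"
proof -
  have "(\<lambda>\<omega>. (\<lambda>(\<omega>, u). X (max 0 u) \<omega>) (\<omega>, T t \<omega>)) \<in> borel_measurable S"
    using T by (intro measurable_compose[OF _ continuous_process_jointly_measurable[OF X cont]]) auto
  then show ?thesis by (simp add: time_change_def[abs_def])
qed

text \<open>Packages the generated sigma-algebra as a measure object, so that measurability with
  respect to the history of a process can be expressed by
  \<open>\<rightarrow>\<^sub>M\<close>.\<close>

definition process_algebra ::
  "'a measure \<Rightarrow> (real \<Rightarrow> 'a \<Rightarrow> 'b::topological_space) \<Rightarrow> 'a measure" where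
  "process_algebra M X = sigma (space M) {X t -` A \<inter> space M |t A. 0 \<le> t \<and> A \<in> sets borel}"

lemma space_process_algebra [simp]: "space (process_algebra M X) = space M"
  unfolding process_algebra_def by (rule space_measure_of) auto

lemma sets_process_algebra: "sets (process_algebra M X) = process_sigma_sets M X"
  unfolding process_algebra_def process_sigma_sets_def by (rule sets_measure_of) auto

lemma process_algebra_measurable:
  assumes "t \<ge> 0"
  shows "X t \<in> process_algebra M X \<rightarrow>\<^sub>M borel"
proof (rule measurableI)
  fix A :: "'b set" assume "A \<in> sets borel"
  with assms show "X t -` A \<inter> space (process_algebra M X) \<in> sets (process_algebra M X)"
    unfolding sets_process_algebra process_sigma_sets_def
    by (intro sigma_sets.Basic) auto
qed simp

section \<open>Joint laws and expectations for independent processes\<close>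

context prob_space
begin

text \<open>Preimages under \<open>U\<close> and \<open>V\<close> lie in the two generated
  sigma-algebras, so independence factorises the probability of every rectangle, and rectangles
  determine the product measure. The target spaces are arbitrary, so that \<open>U\<close> may be
  the whole sample point and \<open>V\<close> a pair of random times.\<close>

lemma indep_processes_joint_distr:
  assumes ind: "indep_processes M X Y"
    and U: "U \<in> process_algebra M X \<rightarrow>\<^sub>M S" and V: "V \<in> process_algebra M Y \<rightarrow>\<^sub>M T"
  shows "random_variable S U" "random_variable T V"
    and "distr M S U \<Otimes>\<^sub>M distr M T V = distr M (S \<Otimes>\<^sub>M T) (\<lambda>\<omega>. (U \<omega>, V \<omega>))"
proof -
  have ind': "indep_set (process_sigma_sets M X) (process_sigma_sets M Y)"
    using ind by (simp add: indep_processes_def)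
  then have ev: "process_sigma_sets M X \<subseteq> events" "process_sigma_sets M Y \<subseteq> events"
    by (auto dest: indep_setD_ev1 indep_setD_ev2)
  then show rv[measurable]: "random_variable S U" "random_variable T V"
    using U V by (auto simp: measurable_def sets_process_algebra)
  interpret U: prob_space "distr M S U" by (rule prob_space_distr) fact
  interpret V: prob_space "distr M T V" by (rule prob_space_distr) fact
  show "distr M S U \<Otimes>\<^sub>M distr M T V = distr M (S \<Otimes>\<^sub>M T) (\<lambda>\<omega>. (U \<omega>, V \<omega>))" (is "_ = ?J")
  proof (rule pair_measure_eqI)
    fix A B assume A: "A \<in> sets (distr M S U)" and B: "B \<in> sets (distr M T V)"
    have sets: "U -` A \<inter> space M \<in> process_sigma_sets M X" "V -` B \<inter> space M \<in> process_sigma_sets M Y"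
      using measurable_sets[OF U, of A] measurable_sets[OF V, of B] A B
      by (simp_all add: sets_process_algebra)
    have "emeasure ?J (A \<times> B) = emeasure M ((\<lambda>\<omega>. (U \<omega>, V \<omega>)) -` (A \<times> B) \<inter> space M)"
      using A B by (intro emeasure_distr) auto
    also have "(\<lambda>\<omega>. (U \<omega>, V \<omega>)) -` (A \<times> B) \<inter> space M = (U -` A \<inter> space M) \<inter> (V -` B \<inter> space M)"
      by auto
    also have "emeasure M \<dots> = emeasure M (U -` A \<inter> space M) * emeasure M (V -` B \<inter> space M)"
      using indep_setD[OF ind' sets] by (simp add: emeasure_eq_measure ennreal_mult)
    also have "\<dots> = emeasure (distr M S U) A * emeasure (distr M T V) B"
      using A B by (simp add: emeasure_distr)
    finally show "emeasure (distr M S U) A * emeasure (distr M T V) B = emeasure ?J (A \<times> B)" by simp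
  qed (simp_all add: U.sigma_finite_measure_axioms V.sigma_finite_measure_axioms)
qed

text \<open>Tonelli's theorem for the product of the two laws. It serves as conditioning:
  \<open>V\<close> is frozen at \<open>\<omega>'\<close> while the average over \<open>U\<close> is
  taken. As no integrability is assumed, it can be used to prove finiteness of second
  moments.\<close>

lemma indep_processes_nn_integral:
  assumes ind: "indep_processes M X Y"
    and U: "U \<in> process_algebra M X \<rightarrow>\<^sub>M S" and V: "V \<in> process_algebra M Y \<rightarrow>\<^sub>M T"
    and h[measurable]: "h \<in> borel_measurable (S \<Otimes>\<^sub>M T)"
  shows "(\<integral>\<^sup>+\<omega>. h (U \<omega>, V \<omega>) \<partial>M) = (\<integral>\<^sup>+\<omega>'. \<integral>\<^sup>+\<omega>. h (U \<omega>, V \<omega>') \<partial>M \<partial>M)"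
proof -
  note rv[measurable] = indep_processes_joint_distr(1,2)[OF ind U V]
  note eq = indep_processes_joint_distr(3)[OF ind U V]
  interpret U: prob_space "distr M S U" by (rule prob_space_distr) simp
  interpret V: prob_space "distr M T V" by (rule prob_space_distr) simp
  interpret UV: pair_sigma_finite "distr M S U" "distr M T V" ..
  have "(\<integral>\<^sup>+\<omega>. h (U \<omega>, V \<omega>) \<partial>M) = integral\<^sup>N (distr M S U \<Otimes>\<^sub>M distr M T V) h"
    unfolding eq by (subst nn_integral_distr) auto
  also have "\<dots> = (\<integral>\<^sup>+y. \<integral>\<^sup>+x. h (x, y) \<partial>distr M S U \<partial>distr M T V)"
    by (subst UV.nn_integral_snd) auto
  also have "\<dots> = (\<integral>\<^sup>+\<omega>'. \<integral>\<^sup>+x. h (x, V \<omega>') \<partial>distr M S U \<partial>M)"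
    by (subst nn_integral_distr) auto
  also have "\<dots> = (\<integral>\<^sup>+\<omega>'. \<integral>\<^sup>+\<omega>. h (U \<omega>, V \<omega>') \<partial>M \<partial>M)"
    by (intro nn_integral_cong nn_integral_distr) (auto dest: measurable_space[OF rv(2)])
  finally show ?thesis .
qed

text \<open>The Fubini counterpart for integrands of either sign, used for means and covariances
  once integrability is known.\<close>

lemma indep_processes_integral:
  fixes h :: "_ \<Rightarrow> real"
  assumes ind: "indep_processes M X Y"
    and U: "U \<in> process_algebra M X \<rightarrow>\<^sub>M S" and V: "V \<in> process_algebra M Y \<rightarrow>\<^sub>M T"
    and h[measurable]: "h \<in> borel_measurable (S \<Otimes>\<^sub>M T)"
    and int: "integrable M (\<lambda>\<omega>. h (U \<omega>, V \<omega>))"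
  shows "(\<integral>\<omega>. h (U \<omega>, V \<omega>) \<partial>M) = (\<integral>\<omega>'. \<integral>\<omega>. h (U \<omega>, V \<omega>') \<partial>M \<partial>M)"
proof -
  note rv[measurable] = indep_processes_joint_distr(1,2)[OF ind U V]
  note eq = indep_processes_joint_distr(3)[OF ind U V]
  interpret U: prob_space "distr M S U" by (rule prob_space_distr) simp
  interpret V: prob_space "distr M T V" by (rule prob_space_distr) simp
  interpret UV: pair_sigma_finite "distr M S U" "distr M T V" ..
  have int': "integrable (distr M S U \<Otimes>\<^sub>M distr M T V) h"
    unfolding eq by (subst integrable_distr_eq) (auto intro: int)
  have "(\<integral>\<omega>. h (U \<omega>, V \<omega>) \<partial>M) = integral\<^sup>L (distr M S U \<Otimes>\<^sub>M distr M T V) h"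
    unfolding eq by (subst integral_distr) auto
  also have "\<dots> = (\<integral>y. \<integral>x. h (x, y) \<partial>distr M S U \<partial>distr M T V)"
    by (subst UV.integral_snd[of "\<lambda>x y. h (x, y)"]) (use int' in auto)
  also have "\<dots> = (\<integral>\<omega>'. \<integral>x. h (x, V \<omega>') \<partial>distr M S U \<partial>M)"
    by (subst integral_distr) auto
  also have "\<dots> = (\<integral>\<omega>'. \<integral>\<omega>. h (U \<omega>, V \<omega>') \<partial>M \<partial>M)"
    by (intro Bochner_Integration.integral_cong refl integral_distr)
      (auto dest: measurable_space[OF rv(2)])
  finally show ?thesis .
qed

end

text \<open>The product is dominated in absolute value by the sum of the two squares.\<close>

lemma integrable_mult_of_squares:
  fixes f g :: "'a \<Rightarrow> real"
  assumes [measurable]: "f \<in> borel_measurable M" "g \<in> borel_measurable M"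
    and "integrable M (\<lambda>x. (f x)\<^sup>2)" "integrable M (\<lambda>x. (g x)\<^sup>2)"
  shows "integrable M (\<lambda>x. f x * g x)"
proof (rule Bochner_Integration.integrable_bound)
  show "integrable M (\<lambda>x. (f x)\<^sup>2 + (g x)\<^sup>2)" using assms by auto
  have "\<bar>f x * g x\<bar> \<le> (f x)\<^sup>2 + (g x)\<^sup>2" for x
  proof -
    have "0 \<le> \<bar>f x\<bar> * \<bar>g x\<bar>" by simp
    moreover have "2 * \<bar>f x\<bar> * \<bar>g x\<bar> \<le> (f x)\<^sup>2 + (g x)\<^sup>2"
      using sum_squares_bound[of "\<bar>f x\<bar>" "\<bar>g x\<bar>"] by simp
    ultimately show ?thesis unfolding abs_mult by linarith
  qed
  then show "AE x in M. norm (f x * g x) \<le> norm ((f x)\<^sup>2 + (g x)\<^sup>2)" by simp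
qed simp

section \<open>Mixed fractional Brownian motion\<close>

text \<open>Measurability is part of \<open>gaussian_variable\<close>, here applied to the linear
  combination with the single index \<open>t\<close> and coefficient 1.\<close>

lemma fbm_measurable:
  assumes "fractional_brownian_motion M H B" "t \<ge> 0"
  shows "B t \<in> borel_measurable M"
proof -
  have *: "gaussian_variable M (\<lambda>\<omega>. \<Sum>t\<in>I. c t * B t \<omega>)" if "finite I" "I \<subseteq> {0..}" for I c
    using assms(1) that by (auto simp: fractional_brownian_motion_def gaussian_process_def)
  show ?thesis
    using *[of "{t}" "\<lambda>_. 1"] assms(2) by (simp add: gaussian_variable_def)
qed

text \<open>The parameter \<open>p\<close> is twice the Hurst index, which makes it the order of the
  Gamma moments that arise when \<open>u\<close> and \<open>v\<close> become random times.\<close>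

definition fbm_covariance :: "real \<Rightarrow> real \<Rightarrow> real \<Rightarrow> real" where
  "fbm_covariance p u v = (u powr p + v powr p - \<bar>u - v\<bar> powr p) / 2"

lemma fbm_mean:
  assumes "fractional_brownian_motion M H B" "t \<ge> 0"
  shows "(\<integral>\<omega>. B t \<omega> \<partial>M) = 0"
  using assms unfolding fractional_brownian_motion_def by blast

lemma fbm_cov:
  assumes "fractional_brownian_motion M H B" "s \<ge> 0" "t \<ge> 0"
  shows "(\<integral>\<omega>. B s \<omega> * B t \<omega> \<partial>M) = fbm_covariance (2 * H) s t"
  using assms unfolding fractional_brownian_motion_def fbm_covariance_def by blast

text \<open>Integrability comes for free: a non-integrable function has Bochner integral \<open>0\<close>, while the
  prescribed variance is positive at positive times.\<close>

lemma fbm_square_integrable: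
  assumes B: "fractional_brownian_motion M H B" and t: "t \<ge> 0"
  shows "integrable M (\<lambda>\<omega>. (B t \<omega>)\<^sup>2)"
proof (cases "t = 0")
  case True
  have "AE \<omega> in M. (B t \<omega>)\<^sup>2 = 0"
    using B True by (auto simp: fractional_brownian_motion_def)
  then show ?thesis
    using integrable_cong_AE[of "\<lambda>\<omega>. (B t \<omega>)\<^sup>2" M "\<lambda>_. 0"] fbm_measurable[OF B t] by simp
next
  case False
  have "(\<integral>\<omega>. B t \<omega> * B t \<omega> \<partial>M) = t powr (2 * H)"
    using fbm_cov[OF B t t] by (simp add: fbm_covariance_def)
  then have "(\<integral>\<omega>. (B t \<omega>)\<^sup>2 \<partial>M) \<noteq> 0" using False t by (simp add: power2_eq_square)
  then show ?thesis using not_integrable_integral_eq by blast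
qed

locale mixed_fbm = prob_space +
  fixes H1 H2 a b :: real and B1 B2 N :: "real \<Rightarrow> 'a \<Rightarrow> real"
  assumes mixed: "generalized_mixed_fbm M H1 H2 a b B1 B2 N"
begin

definition mixed_covariance :: "real \<Rightarrow> real \<Rightarrow> real" where
  "mixed_covariance u v = a\<^sup>2 * fbm_covariance (2 * H1) u v + b\<^sup>2 * fbm_covariance (2 * H2) u v"

lemma fbm: "fractional_brownian_motion M H1 B1" "fractional_brownian_motion M H2 B2"
  and indep: "indep_processes M B1 B2" and N_eq: "N = mixed_process a b B1 B2"
  using mixed by (auto simp: generalized_mixed_fbm_def)

lemma N_path_continuous: "\<omega> \<in> space M \<Longrightarrow> continuous_on {0..} (\<lambda>t. N t \<omega>)"
  using fbm unfolding N_eq mixed_process_def fractional_brownian_motion_def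
  by (auto intro!: continuous_intros)

lemma N_measurable: "t \<ge> 0 \<Longrightarrow> N t \<in> borel_measurable M"
  using fbm_measurable[OF fbm(1)] fbm_measurable[OF fbm(2)]
  unfolding N_eq mixed_process_def[abs_def] by auto

text \<open>Independence from the Gamma process is given for the pair of Brownian motions, so the
  mixed process has to be measurable with respect to the sigma-algebra of that pair.\<close>

lemma N_process_algebra_measurable:
  assumes t: "t \<ge> 0"
  shows "N t \<in> borel_measurable (process_algebra M (\<lambda>t \<omega>. (B1 t \<omega>, B2 t \<omega>)))"
proof -
  have meas: "(\<lambda>\<omega>. (B1 t \<omega>, B2 t \<omega>)) \<in> process_algebra M (\<lambda>t \<omega>. (B1 t \<omega>, B2 t \<omega>)) \<rightarrow>\<^sub>M borel"
    using t by (rule process_algebra_measurable)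
  have "(\<lambda>x :: real \<times> real. a * fst x + b * snd x) \<in> borel_measurable borel"
    by (intro borel_measurable_continuous_onI continuous_intros)
  from measurable_compose[OF meas this]
  show ?thesis unfolding N_eq mixed_process_def[abs_def] by simp
qed

text \<open>After expanding the product, the cross terms vanish because the two Brownian motions are
  independent and centred.\<close>

lemma N_moments:
  assumes s: "s \<ge> 0" and t: "t \<ge> 0"
  shows "integrable M (\<lambda>\<omega>. (N t \<omega>)\<^sup>2)"
    and "expectation (N t) = 0"
    and "expectation (\<lambda>\<omega>. N s \<omega> * N t \<omega>) = mixed_covariance s t"
proof -
  note meas[measurable] = fbm_measurable[OF fbm(1) s] fbm_measurable[OF fbm(1) t]
     fbm_measurable[OF fbm(2) s] fbm_measurable[OF fbm(2) t]
  note sq = fbm_square_integrable[OF fbm(1) s] fbm_square_integrable[OF fbm(1) t]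
     fbm_square_integrable[OF fbm(2) s] fbm_square_integrable[OF fbm(2) t]
  have int: "integrable M (B1 s)" "integrable M (B2 s)" "integrable M (B1 t)" "integrable M (B2 t)"
    by (rule square_integrable_imp_integrable; fact)+
  have zero: "expectation (B1 s) = 0" "expectation (B2 s) = 0"
      "expectation (B1 t) = 0" "expectation (B2 t) = 0"
    using fbm_mean[OF fbm(1)] fbm_mean[OF fbm(2)] s t by blast+
  have ind: "indep_var borel (B1 u) borel (B2 v)" if "u \<ge> 0" "v \<ge> 0" for u v
    using indep_processes_joint_distr[OF indep process_algebra_measurable[OF that(1)]
        process_algebra_measurable[OF that(2)]]
    by (simp add: indep_var_distribution_eq)
  have cross: "expectation (\<lambda>\<omega>. B1 s \<omega> * B2 t \<omega>) = 0" "expectation (\<lambda>\<omega>. B1 t \<omega> * B2 s \<omega>) = 0"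
    using indep_var_lebesgue_integral[OF ind[OF s t]] indep_var_lebesgue_integral[OF ind[OF t s]]
      int zero by auto
  have prods: "integrable M (\<lambda>\<omega>. B1 s \<omega> * B1 t \<omega>)" "integrable M (\<lambda>\<omega>. B1 s \<omega> * B2 t \<omega>)"
     "integrable M (\<lambda>\<omega>. B1 t \<omega> * B2 s \<omega>)" "integrable M (\<lambda>\<omega>. B2 s \<omega> * B2 t \<omega>)"
     "integrable M (\<lambda>\<omega>. B1 t \<omega> * B2 t \<omega>)"
    by (rule integrable_mult_of_squares; fact)+
  show "expectation (N t) = 0"
    using int zero unfolding N_eq mixed_process_def[abs_def] by auto
  have eq: "(\<lambda>\<omega>. (N t \<omega>)\<^sup>2) = (\<lambda>\<omega>. a\<^sup>2 * (B1 t \<omega>)\<^sup>2 + b\<^sup>2 * (B2 t \<omega>)\<^sup>2 + 2 * a * b * (B1 t \<omega> * B2 t \<omega>))"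
    by (auto simp: N_eq mixed_process_def power2_eq_square algebra_simps)
  show "integrable M (\<lambda>\<omega>. (N t \<omega>)\<^sup>2)"
    unfolding eq by (intro Bochner_Integration.integrable_add integrable_mult_right sq prods)
  have eq: "(\<lambda>\<omega>. N s \<omega> * N t \<omega>) = (\<lambda>\<omega>. a\<^sup>2 * (B1 s \<omega> * B1 t \<omega>) + b\<^sup>2 * (B2 s \<omega> * B2 t \<omega>)
      + a * b * (B1 s \<omega> * B2 t \<omega>) + a * b * (B1 t \<omega> * B2 s \<omega>))"
    by (auto simp: N_eq mixed_process_def power2_eq_square algebra_simps)
  note cov = fbm_cov[OF fbm(1) s t] fbm_cov[OF fbm(2) s t]
  show "expectation (\<lambda>\<omega>. N s \<omega> * N t \<omega>) = mixed_covariance s t"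
    unfolding eq mixed_covariance_def by (simp add: prods cross cov)
qed

end

section \<open>Time change by a Gamma process\<close>

lemma gamma_density_AE_pos:
  assumes "prob_space M" and X: "distributed M lborel X (\<lambda>x. ennreal (gamma_process_density \<nu> t x))"
  shows "AE \<omega> in M. X \<omega> > 0"
proof -
  interpret prob_space M by fact
  show ?thesis
    by (subst distributed_AE2[OF X]) (auto simp: gamma_process_density_def)
qed

text \<open>Multiplying the density of shape \<open>q = t / \<nu>\<close> by \<open>x powr p\<close>
  gives, up to the factor \<open>1 / Gamma q\<close>, the Gamma integrand of shape
  \<open>q + p\<close>. The clamp \<open>max 0\<close> matches the one in
  \<open>time_change\<close>.\<close>

lemma gamma_density_moment:
  assumes X: "distributed M lborel X (\<lambda>x. ennreal (gamma_process_density \<nu> t x))"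
    and t: "t > 0" and \<nu>: "\<nu> > 0" and p: "p > 0"
  shows "has_bochner_integral M (\<lambda>\<omega>. max 0 (X \<omega>) powr p) (Gamma_moment p (t / \<nu>))"
proof (rule has_bochner_integral_nn_integral)
  define q where "q = t / \<nu>"
  have q: "q > 0" using t \<nu> by (simp add: q_def)
  have [measurable]: "X \<in> borel_measurable M"
    using distributed_measurable[OF X] by simp
  show "(\<lambda>\<omega>. max 0 (X \<omega>) powr p) \<in> borel_measurable M" by measurable
  show "0 \<le> Gamma_moment p (t / \<nu>)"
    using Gamma_moment_pos[OF q p] by (simp add: q_def)
  have "(\<integral>\<^sup>+\<omega>. ennreal (max 0 (X \<omega>) powr p) \<partial>M) =
      (\<integral>\<^sup>+x. ennreal (gamma_process_density \<nu> t x) * ennreal (max 0 x powr p) \<partial>lborel)"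
    by (rule distributed_nn_integral[OF X, symmetric]) measurable
  also have "\<dots> = (\<integral>\<^sup>+x. ennreal (1 / Gamma q) *
      ennreal (indicator {0..} x * x powr (q + p - 1) / exp x) \<partial>lborel)"
  proof (rule nn_integral_cong)
    fix x :: real
    show "ennreal (gamma_process_density \<nu> t x) * ennreal (max 0 x powr p) =
      ennreal (1 / Gamma q) * ennreal (indicator {0..} x * x powr (q + p - 1) / exp x)"
    proof (cases "x > 0")
      case True
      have "x powr (q - 1) * x powr p = x powr (q + p - 1)"
        using True by (simp flip: powr_add add: algebra_simps)
      then have "gamma_process_density \<nu> t x * max 0 x powr p =
          1 / Gamma q * (indicator {0..} x * x powr (q + p - 1) / exp x)"
        using True by (simp add: gamma_process_density_def q_def[symmetric] exp_minus field_simps)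
      moreover have "gamma_process_density \<nu> t x \<ge> 0" "1 / Gamma q \<ge> 0"
        using q True by (simp_all add: gamma_process_density_def q_def[symmetric] less_imp_le)
      ultimately show ?thesis
        by (simp flip: ennreal_mult')
    \<comment> \<open>At \<open>x = 0\<close> the indicator equals 1, and the right side vanishes
      only because \<open>0 powr r = 0\<close>.\<close>
    qed (auto simp: gamma_process_density_def indicator_def)
  qed
  also have "\<dots> = ennreal (1 / Gamma q) * ennreal (Gamma (q + p))"
    by (subst nn_integral_cmult) (use q p Gamma_conv_nn_integral_real[of "q + p"] in auto)
  also have "\<dots> = ennreal (Gamma_moment p (t / \<nu>))"
    using q p by (simp add: Gamma_moment_def q_def[symmetric] less_imp_le flip: ennreal_mult')
  finally show "(\<integral>\<^sup>+\<omega>. ennreal (max 0 (X \<omega>) powr p) \<partial>M) = ennreal (Gamma_moment p (t / \<nu>))" .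
qed simp

lemma gamma_process_increment:
  assumes "gamma_process M \<nu> \<Gamma>" "0 \<le> s" "s < t"
  shows "distributed M lborel (\<lambda>\<omega>. \<Gamma> t \<omega> - \<Gamma> s \<omega>) (\<lambda>x. ennreal (gamma_process_density \<nu> (t - s) x))"
proof -
  have "\<forall>s\<ge>0. \<forall>t>0. distributed M lborel (\<lambda>\<omega>. \<Gamma> (t + s) \<omega> - \<Gamma> s \<omega>)
        (\<lambda>x. ennreal (gamma_process_density \<nu> t x))"
    using assms(1) by (simp add: gamma_process_def)
  from this[rule_format, of s "t - s"] show ?thesis using assms by simp
qed

lemma gamma_process_AE_mono:
  assumes "prob_space M" "gamma_process M \<nu> \<Gamma>" "0 \<le> s" "s < t"
  shows "AE \<omega> in M. \<Gamma> s \<omega> < \<Gamma> t \<omega>"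
  using gamma_density_AE_pos[OF assms(1) gamma_process_increment[OF assms(2-4)]] by simp

lemma gamma_process_moment:
  assumes \<Gamma>: "gamma_process M \<nu> \<Gamma>" and t: "t > 0" and p: "p > 0"
  shows "has_bochner_integral M (\<lambda>\<omega>. max 0 (\<Gamma> t \<omega>) powr p) (Gamma_moment p (t / \<nu>))"
proof -
  have \<nu>: "\<nu> > 0" and [measurable]: "\<Gamma> t \<in> borel_measurable M" "\<Gamma> 0 \<in> borel_measurable M"
    and zero: "AE \<omega> in M. \<Gamma> 0 \<omega> = 0"
    using \<Gamma> t by (simp_all add: gamma_process_def)
  have "has_bochner_integral M (\<lambda>\<omega>. max 0 (\<Gamma> t \<omega> - \<Gamma> 0 \<omega>) powr p) (Gamma_moment p ((t - 0) / \<nu>))"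
    using gamma_process_increment[OF \<Gamma>, of 0 t] t by (intro gamma_density_moment \<nu> p) auto
  moreover have "AE \<omega> in M. max 0 (\<Gamma> t \<omega> - \<Gamma> 0 \<omega>) powr p = max 0 (\<Gamma> t \<omega>) powr p"
    using zero by eventually_elim simp
  ultimately show ?thesis
    by (subst has_bochner_integral_cong_AE[where g="\<lambda>\<omega>. max 0 (\<Gamma> t \<omega> - \<Gamma> 0 \<omega>) powr p"]) auto
qed

text \<open>Almost surely \<open>\<Gamma> 0 = 0\<close> and
  \<open>\<Gamma> 0 < \<Gamma> s < \<Gamma> t\<close>. Hence the clamps have no effect and the
  absolute value is the increment, which has a Gamma law of shape
  \<open>(t - s) / \<nu>\<close>.\<close>

lemma gamma_process_increment_moment:
  assumes M: "prob_space M" and \<Gamma>: "gamma_process M \<nu> \<Gamma>" and s: "s > 0" and t: "s < t" and p: "p > 0"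
  shows "has_bochner_integral M (\<lambda>\<omega>. \<bar>max 0 (\<Gamma> s \<omega>) - max 0 (\<Gamma> t \<omega>)\<bar> powr p)
    (Gamma_moment p ((t - s) / \<nu>))"
proof -
  have \<nu>: "\<nu> > 0" and [measurable]: "\<Gamma> t \<in> borel_measurable M" "\<Gamma> s \<in> borel_measurable M"
    and zero: "AE \<omega> in M. \<Gamma> 0 \<omega> = 0"
    using \<Gamma> t s by (simp_all add: gamma_process_def)
  have "has_bochner_integral M (\<lambda>\<omega>. max 0 (\<Gamma> t \<omega> - \<Gamma> s \<omega>) powr p) (Gamma_moment p ((t - s) / \<nu>))"
    using gamma_process_increment[OF \<Gamma>, of s t] t s by (intro gamma_density_moment \<nu> p) auto
  moreover have "AE \<omega> in M. max 0 (\<Gamma> t \<omega> - \<Gamma> s \<omega>) powr p = \<bar>max 0 (\<Gamma> s \<omega>) - max 0 (\<Gamma> t \<omega>)\<bar> powr p"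
    using zero gamma_process_AE_mono[OF M \<Gamma> order_refl s] gamma_process_AE_mono[OF M \<Gamma> less_imp_le[OF s] t]
    by eventually_elim (simp add: max_def)
  ultimately show ?thesis
    by (subst has_bochner_integral_cong_AE[where g="\<lambda>\<omega>. max 0 (\<Gamma> t \<omega> - \<Gamma> s \<omega>) powr p"]) auto
qed

section \<open>Moments and correlation of the time-changed process\<close>

locale gamma_changed_fbm = mixed_fbm +
  fixes \<nu> :: real and \<Gamma> :: "real \<Rightarrow> 'a \<Rightarrow> real"
  assumes gamma: "gamma_process M \<nu> \<Gamma>"
    and indep_gamma: "indep_processes M (\<lambda>t \<omega>. (B1 t \<omega>, B2 t \<omega>)) \<Gamma>"
begin

definition fbm_moment :: "real \<Rightarrow> real \<Rightarrow> real \<Rightarrow> real" where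
  "fbm_moment p s t =
    (Gamma_moment p (s / \<nu>) + Gamma_moment p (t / \<nu>) - Gamma_moment p ((t - s) / \<nu>)) / 2"

lemma \<nu>_pos: "\<nu> > 0" and H_pos: "H1 > 0" "H2 > 0" and \<Gamma>_measurable: "t \<ge> 0 \<Longrightarrow> \<Gamma> t \<in> borel_measurable M"
  using gamma fbm by (auto simp: gamma_process_def fractional_brownian_motion_def)

lemma covariance_of_times:
  assumes s: "s > 0" and t: "s < t" and p: "p > 0"
  shows "has_bochner_integral M (\<lambda>\<omega>. fbm_covariance p (max 0 (\<Gamma> s \<omega>)) (max 0 (\<Gamma> t \<omega>))) (fbm_moment p s t)"
  unfolding fbm_covariance_def fbm_moment_def
  using s t p gamma prob_space_axioms
  by (intro has_bochner_integral_divide_zero has_bochner_integral_add has_bochner_integral_diff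
      gamma_process_moment gamma_process_increment_moment) auto

lemma variance_of_time:
  assumes t: "t > 0" and p: "p > 0"
  shows "has_bochner_integral M (\<lambda>\<omega>. fbm_covariance p (max 0 (\<Gamma> t \<omega>)) (max 0 (\<Gamma> t \<omega>)))
    (Gamma_moment p (t / \<nu>))"
  using gamma_process_moment[OF gamma t p] by (simp add: fbm_covariance_def)

lemma mixed_covariance_of_times:
  assumes s: "s > 0" and t: "s < t"
  shows "has_bochner_integral M (\<lambda>\<omega>. mixed_covariance (max 0 (\<Gamma> s \<omega>)) (max 0 (\<Gamma> t \<omega>)))
    (a\<^sup>2 * fbm_moment (2 * H1) s t + b\<^sup>2 * fbm_moment (2 * H2) s t)"
  unfolding mixed_covariance_def using H_pos
  by (intro has_bochner_integral_add has_bochner_integral_mult_right covariance_of_times s t) auto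

lemma mixed_variance_of_time:
  assumes t: "t > 0"
  shows "has_bochner_integral M (\<lambda>\<omega>. mixed_covariance (max 0 (\<Gamma> t \<omega>)) (max 0 (\<Gamma> t \<omega>)))
    (a\<^sup>2 * Gamma_moment (2 * H1) (t / \<nu>) + b\<^sup>2 * Gamma_moment (2 * H2) (t / \<nu>))"
  unfolding mixed_covariance_def using H_pos
  by (intro has_bochner_integral_add has_bochner_integral_mult_right variance_of_time t) auto

abbreviation "\<A> \<equiv> process_algebra M (\<lambda>t \<omega>. (B1 t \<omega>, B2 t \<omega>))"

lemma N_jointly_measurable: "(\<lambda>(\<omega>, u). N (max 0 u) \<omega>) \<in> borel_measurable (\<A> \<Otimes>\<^sub>M borel)"
  by (rule continuous_process_jointly_measurable)
    (auto intro: N_process_algebra_measurable N_path_continuous)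

lemma changed_measurable: "t \<ge> 0 \<Longrightarrow> time_change N \<Gamma> t \<in> borel_measurable M"
  by (intro time_change_measurable N_measurable N_path_continuous \<Gamma>_measurable)

text \<open>Taking the identity as \<open>U\<close> in the independence formulas lets the sample
  point itself carry the whole path of \<open>N\<close>, which can then be evaluated at frozen
  times.\<close>

lemma id_measurable: "(\<lambda>\<omega>. \<omega>) \<in> \<A> \<rightarrow>\<^sub>M \<A>"
  by (rule measurable_ident_sets) simp

text \<open>With the random time frozen at \<open>u\<close>, the inner integral is the variance
  \<open>mixed_covariance u u\<close>. Its average over the Gamma time is finite because Gamma
  moments are finite.\<close>

lemma changed_square_integrable:
  assumes t: "t \<ge> 0"
  shows "integrable M (\<lambda>\<omega>. (time_change N \<Gamma> t \<omega>)\<^sup>2)"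
proof -
  note [measurable] = \<Gamma>_measurable[OF t] changed_measurable[OF t]
  have int: "integrable M (\<lambda>\<omega>. mixed_covariance (max 0 (\<Gamma> t \<omega>)) (max 0 (\<Gamma> t \<omega>)))"
  \<comment> \<open>The moment formula needs \<open>t > 0\<close>. At time 0 the random time is
    almost surely 0, and the variance vanishes there because \<open>0 powr r = 0\<close>.\<close>
  proof (cases "t = 0")
    case True
    have "AE \<omega> in M. \<Gamma> 0 \<omega> = 0" using gamma by (simp add: gamma_process_def)
    then have "AE \<omega> in M. mixed_covariance (max 0 (\<Gamma> t \<omega>)) (max 0 (\<Gamma> t \<omega>)) = 0"
      by eventually_elim (simp add: True mixed_covariance_def fbm_covariance_def)
    moreover have "(\<lambda>\<omega>. mixed_covariance (max 0 (\<Gamma> t \<omega>)) (max 0 (\<Gamma> t \<omega>))) \<in> borel_measurable M"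
      unfolding mixed_covariance_def fbm_covariance_def by measurable
    ultimately show ?thesis
      using integrable_cong_AE[of "\<lambda>\<omega>. mixed_covariance (max 0 (\<Gamma> t \<omega>)) (max 0 (\<Gamma> t \<omega>))" M "\<lambda>_. 0"]
      by simp
  next
    case False
    with t show ?thesis using mixed_variance_of_time[of t] by (simp add: has_bochner_integral_iff)
  qed
  have nonneg: "mixed_covariance u u \<ge> 0" for u
    by (simp add: mixed_covariance_def fbm_covariance_def)
  have "(\<lambda>x. ennreal (((\<lambda>(\<omega>, u). N (max 0 u) \<omega>) x)\<^sup>2)) \<in> borel_measurable (\<A> \<Otimes>\<^sub>M borel)"
    using N_jointly_measurable by measurable
  from indep_processes_nn_integral[OF indep_gamma id_measurable process_algebra_measurable[OF t] this]
  have "(\<integral>\<^sup>+\<omega>. ennreal ((time_change N \<Gamma> t \<omega>)\<^sup>2) \<partial>M) =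
      (\<integral>\<^sup>+\<omega>'. \<integral>\<^sup>+\<omega>. ennreal ((N (max 0 (\<Gamma> t \<omega>')) \<omega>)\<^sup>2) \<partial>M \<partial>M)"
    by (simp add: time_change_def)
  also have "\<dots> = (\<integral>\<^sup>+\<omega>'. ennreal (mixed_covariance (max 0 (\<Gamma> t \<omega>')) (max 0 (\<Gamma> t \<omega>'))) \<partial>M)"
  proof (rule nn_integral_cong)
    fix \<omega>'
    have u: "max 0 (\<Gamma> t \<omega>') \<ge> 0" by simp
    show "(\<integral>\<^sup>+\<omega>. ennreal ((N (max 0 (\<Gamma> t \<omega>')) \<omega>)\<^sup>2) \<partial>M) =
        ennreal (mixed_covariance (max 0 (\<Gamma> t \<omega>')) (max 0 (\<Gamma> t \<omega>')))"
      using N_moments(1,3)[OF u u] by (subst nn_integral_eq_integral) (auto simp: power2_eq_square)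
  qed
  also have "\<dots> < \<infinity>"
    using nonneg int by (subst nn_integral_eq_integral) auto
  finally show ?thesis
    by (intro integrableI_nonneg) auto
qed

text \<open>Square integrability on a probability space gives integrability, so Fubini applies, and
  the mean at every frozen time is 0.\<close>

lemma changed_expectation:
  assumes t: "t \<ge> 0"
  shows "expectation (time_change N \<Gamma> t) = 0"
proof -
  have "integrable M (time_change N \<Gamma> t)"
    using changed_measurable[OF t] changed_square_integrable[OF t]
    by (rule square_integrable_imp_integrable)
  then have "integrable M (\<lambda>\<omega>. (\<lambda>(\<omega>, u). N (max 0 u) \<omega>) (\<omega>, \<Gamma> t \<omega>))"
    by (simp add: time_change_def[abs_def])
  from indep_processes_integral[OF indep_gamma id_measurable process_algebra_measurable[OF t] N_jointly_measurable this]
  have "expectation (time_change N \<Gamma> t) = (\<integral>\<omega>'. expectation (N (max 0 (\<Gamma> t \<omega>'))) \<partial>M)"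
    by (simp add: time_change_def[abs_def])
  also have "\<dots> = 0"
    using N_moments(2)[OF order_refl] by simp
  finally show ?thesis .
qed

text \<open>Conditioning on the pair of random times. The order of \<open>s\<close> and
  \<open>t\<close> is left open, so the case \<open>s = t\<close> yields the variance.\<close>

lemma changed_product_expectation:
  assumes s: "s \<ge> 0" and t: "t \<ge> 0"
  shows "expectation (\<lambda>\<omega>. time_change N \<Gamma> s \<omega> * time_change N \<Gamma> t \<omega>) =
    expectation (\<lambda>\<omega>. mixed_covariance (max 0 (\<Gamma> s \<omega>)) (max 0 (\<Gamma> t \<omega>)))"
proof -
  define h where "h = (\<lambda>(\<omega>, u, v). N (max 0 u) \<omega> * N (max 0 v) \<omega>)"
  have [measurable]: "(\<lambda>(\<omega>, u). N (max 0 u) \<omega>) \<in> borel_measurable (\<A> \<Otimes>\<^sub>M borel)"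
    by (rule N_jointly_measurable)
  have "(\<lambda>x. (\<lambda>(\<omega>, u). N (max 0 u) \<omega>) (fst x, fst (snd x)) * (\<lambda>(\<omega>, u). N (max 0 u) \<omega>) (fst x, snd (snd x)))
      \<in> borel_measurable (\<A> \<Otimes>\<^sub>M (borel \<Otimes>\<^sub>M borel))"
    by measurable
  then have h: "h \<in> borel_measurable (\<A> \<Otimes>\<^sub>M (borel \<Otimes>\<^sub>M borel))"
    by (simp add: h_def case_prod_beta')
  have times: "(\<lambda>\<omega>. (\<Gamma> s \<omega>, \<Gamma> t \<omega>)) \<in> process_algebra M \<Gamma> \<rightarrow>\<^sub>M borel \<Otimes>\<^sub>M borel"
    by (intro measurable_Pair process_algebra_measurable s t)
  have "integrable M (\<lambda>\<omega>. time_change N \<Gamma> s \<omega> * time_change N \<Gamma> t \<omega>)"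
    by (intro integrable_mult_of_squares changed_measurable changed_square_integrable s t)
  then have int: "integrable M (\<lambda>\<omega>. h (\<omega>, (\<Gamma> s \<omega>, \<Gamma> t \<omega>)))"
    by (simp add: time_change_def h_def)
  have "expectation (\<lambda>\<omega>. time_change N \<Gamma> s \<omega> * time_change N \<Gamma> t \<omega>) =
      (\<integral>\<omega>'. \<integral>\<omega>. h (\<omega>, (\<Gamma> s \<omega>', \<Gamma> t \<omega>')) \<partial>M \<partial>M)"
    using indep_processes_integral[OF indep_gamma id_measurable times h int] by (simp add: time_change_def h_def)
  also have "\<dots> = expectation (\<lambda>\<omega>. mixed_covariance (max 0 (\<Gamma> s \<omega>)) (max 0 (\<Gamma> t \<omega>)))"
    by (intro Bochner_Integration.integral_cong refl) (simp add: h_def N_moments(3))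
  finally show ?thesis .
qed

text \<open>Both variables are centred, so the correlation is a quotient of second moments, which
  the averaged covariances express through Gamma moments.\<close>

lemma changed_correlation:
  assumes s: "s > 0" and t: "s < t"
  shows "correlation M (time_change N \<Gamma> t) (time_change N \<Gamma> s) =
    (a\<^sup>2 * fbm_moment (2 * H1) s t + b\<^sup>2 * fbm_moment (2 * H2) s t) /
    (sqrt (a\<^sup>2 * Gamma_moment (2 * H1) (t / \<nu>) + b\<^sup>2 * Gamma_moment (2 * H2) (t / \<nu>)) *
     sqrt (a\<^sup>2 * Gamma_moment (2 * H1) (s / \<nu>) + b\<^sup>2 * Gamma_moment (2 * H2) (s / \<nu>)))"
proof -
  have cov: "expectation (\<lambda>\<omega>. time_change N \<Gamma> t \<omega> * time_change N \<Gamma> s \<omega>) =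
      a\<^sup>2 * fbm_moment (2 * H1) s t + b\<^sup>2 * fbm_moment (2 * H2) s t"
    using changed_product_expectation[of s t] mixed_covariance_of_times[OF s t] s t
    by (simp add: has_bochner_integral_iff mult.commute)
  have var: "expectation (\<lambda>\<omega>. (time_change N \<Gamma> u \<omega>)\<^sup>2) =
      a\<^sup>2 * Gamma_moment (2 * H1) (u / \<nu>) + b\<^sup>2 * Gamma_moment (2 * H2) (u / \<nu>)" if "u > 0" for u
    using changed_product_expectation[of u u] mixed_variance_of_time[OF that] that
    by (simp add: has_bochner_integral_iff power2_eq_square)
  show ?thesis
    using s t by (simp add: correlation_def changed_expectation cov var)
qed

end

section \<open>Decay rate of the correlation\<close>

lemma weighted_limit_pos:
  fixes F D :: "real \<Rightarrow> real \<Rightarrow> real"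
  assumes lim: "\<And>p q. 0 < q \<Longrightarrow> q \<le> p \<Longrightarrow>
      \<exists>k\<ge>0. (q = p \<longrightarrow> k > 0) \<and> ((\<lambda>t. F q t / D p t) \<longlongrightarrow> k) at_top"
    and pq: "0 < q" "q < p" and ab: "a \<noteq> 0 \<or> b \<noteq> 0"
  shows "\<exists>k>0. ((\<lambda>t. (a\<^sup>2 * F q t + b\<^sup>2 * F p t) / D (if b = 0 then q else p) t) \<longlongrightarrow> k) at_top"
\<comment> \<open>The component with the larger exponent \<open>p\<close> dominates as soon as its
  weight \<open>b\<close> is nonzero. Its limit is then strictly positive, and the other component
  adds a nonnegative amount. If \<open>b = 0\<close>, only the exponent \<open>q\<close> is present,
  and \<open>a\<close> must be nonzero.\<close>
proof (cases "b = 0")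
  case True
  obtain k where k: "k > 0" "((\<lambda>t. F q t / D q t) \<longlongrightarrow> k) at_top"
    using lim[of q q] pq by auto
  have "((\<lambda>t. a\<^sup>2 * (F q t / D q t)) \<longlongrightarrow> a\<^sup>2 * k) at_top"
    by (intro tendsto_intros k)
  moreover have "a\<^sup>2 * k > 0" using k True ab by simp
  ultimately show ?thesis using True by auto
next
  case False
  obtain k where k: "k \<ge> 0" "((\<lambda>t. F q t / D p t) \<longlongrightarrow> k) at_top"
    using lim[of q p] pq by auto
  obtain l where l: "l > 0" "((\<lambda>t. F p t / D p t) \<longlongrightarrow> l) at_top"
    using lim[of p p] pq by auto
  have "((\<lambda>t. a\<^sup>2 * (F q t / D p t) + b\<^sup>2 * (F p t / D p t)) \<longlongrightarrow> a\<^sup>2 * k + b\<^sup>2 * l) at_top"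
    by (intro tendsto_intros k l)
  moreover have "a\<^sup>2 * k + b\<^sup>2 * l > 0" using k l False by (intro add_nonneg_pos) auto
  ultimately show ?thesis using False by (intro exI[of _ "a\<^sup>2 * k + b\<^sup>2 * l"]) (simp add: add_divide_distrib)
qed

lemma (in gamma_changed_fbm) changed_long_range_dependent:
  assumes H: "H1 < H2"
  shows "long_range_dependent M (time_change N \<Gamma>)"
proof -
  \<comment> \<open>\<open>p\<close> and \<open>e\<close> are the growth exponents of the variance
    and of the covariance in \<open>t\<close>. Only the square root of the variance at
    \<open>t\<close> enters the denominator, whence \<open>d = p / 2 - e\<close>, that is, the
    minimum of \<open>p / 2\<close> and \<open>1 - p / 2\<close>.\<close>
  define p where "p = (if b = 0 then 2 * H1 else 2 * H2)"
  define e where "e = max 0 (p - 1)"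
  define d where "d = p / 2 - e"
  define V where "V t = a\<^sup>2 * Gamma_moment (2 * H1) (t / \<nu>) + b\<^sup>2 * Gamma_moment (2 * H2) (t / \<nu>)" for t
  define C where "C s t = a\<^sup>2 * fbm_moment (2 * H1) s t + b\<^sup>2 * fbm_moment (2 * H2) s t" for s t
  have ab: "a \<noteq> 0 \<or> b \<noteq> 0" using mixed by (simp add: generalized_mixed_fbm_def)
  \<comment> \<open>Carries limits in the shape parameter \<open>x = t / \<nu>\<close> over to
    limits in \<open>t\<close>.\<close>
  have scale: "filterlim (\<lambda>t. t / \<nu>) at_top at_top"
    using \<nu>_pos by real_asymp
  have V_pos: "V s > 0" if "s > 0" for s
  proof -
    have g: "Gamma_moment (2 * H1) (s / \<nu>) > 0" "Gamma_moment (2 * H2) (s / \<nu>) > 0"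
      using that \<nu>_pos H_pos by (auto intro: Gamma_moment_pos)
    show ?thesis
    proof (cases "b = 0")
      case True
      then show ?thesis using ab g by (simp add: V_def)
    next
      case False
      then show ?thesis using g unfolding V_def by (intro add_nonneg_pos) auto
    qed
  qed
  have "\<exists>k>0. ((\<lambda>t. (a\<^sup>2 * Gamma_moment (2 * H1) (t / \<nu>) + b\<^sup>2 * Gamma_moment (2 * H2) (t / \<nu>)) /
      (t / \<nu>) powr (if b = 0 then 2 * H1 else 2 * H2)) \<longlongrightarrow> k) at_top"
  \<comment> \<open>Applied with \<open>F q t = Gamma_moment q (t / \<nu>)\<close> and
    \<open>D p t = (t / \<nu>) powr p\<close>. The covariance below uses
    \<open>fbm_moment q s t\<close> and the exponent \<open>max 0 (p - 1)\<close> instead.\<close>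
  proof (rule weighted_limit_pos)
    fix p q :: real assume "0 < q" "q \<le> p"
    then obtain k where k: "k \<ge> 0" "q = p \<longrightarrow> k > 0"
        "((\<lambda>x. Gamma_moment q x / x powr p) \<longlongrightarrow> k) at_top"
      using Gamma_moment_variance_asymp by blast
    from filterlim_compose[OF k(3) scale] k(1,2)
    show "\<exists>k\<ge>0. (q = p \<longrightarrow> k > 0) \<and>
        ((\<lambda>t. Gamma_moment q (t / \<nu>) / (t / \<nu>) powr p) \<longlongrightarrow> k) at_top"
      by blast
  qed (use H H_pos ab in auto)
  then obtain v where v: "v > 0" "((\<lambda>t. V t / (t / \<nu>) powr p) \<longlongrightarrow> v) at_top"
    by (auto simp: V_def p_def)
  have cov: "\<exists>k>0. ((\<lambda>t. C s t / (t / \<nu>) powr e) \<longlongrightarrow> k) at_top" if s: "s > 0" for s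
  proof -
    have "\<exists>k>0. ((\<lambda>t. (a\<^sup>2 * fbm_moment (2 * H1) s t + b\<^sup>2 * fbm_moment (2 * H2) s t) /
        (t / \<nu>) powr max 0 ((if b = 0 then 2 * H1 else 2 * H2) - 1)) \<longlongrightarrow> k) at_top"
    proof (rule weighted_limit_pos)
      fix p q :: real assume "0 < q" "q \<le> p"
      \<comment> \<open>The step \<open>h\<close> of the covariance limit is
        \<open>s / \<nu>\<close>, since the increment has shape
        \<open>t / \<nu> - s / \<nu>\<close>.\<close>
      moreover have "s / \<nu> > 0" using s \<nu>_pos by simp
      ultimately obtain k where k: "k \<ge> 0" "q = p \<longrightarrow> k > 0"
        "((\<lambda>x. (Gamma_moment q (s / \<nu>) + Gamma_moment q x - Gamma_moment q (x - s / \<nu>)) / 2 / x powr max 0 (p - 1))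
          \<longlongrightarrow> k) at_top"
        using Gamma_moment_covariance_asymp by blast
      from filterlim_compose[OF k(3) scale] k(1,2)
      show "\<exists>k\<ge>0. (q = p \<longrightarrow> k > 0) \<and>
        ((\<lambda>t. fbm_moment q s t / (t / \<nu>) powr max 0 (p - 1)) \<longlongrightarrow> k) at_top"
        by (auto simp: fbm_moment_def diff_divide_distrib)
    qed (use H H_pos ab in auto)
    then show ?thesis by (simp add: C_def e_def p_def)
  qed
  then obtain k where k: "\<And>s. s > 0 \<Longrightarrow> k s > 0"
    "\<And>s. s > 0 \<Longrightarrow> ((\<lambda>t. C s t / (t / \<nu>) powr e) \<longlongrightarrow> k s) at_top"
    by metis
  \<comment> \<open>The quotient of limits is the constant in the variable \<open>t / \<nu>\<close>;
    the factor \<open>\<nu> powr d\<close> converts it to the variable \<open>t\<close>.\<close>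
  define c where "c s = k s / (sqrt v * sqrt (V s)) * \<nu> powr d" for s
  have c_pos: "c s > 0" if "s > 0" for s
    using that k(1) v(1) V_pos \<nu>_pos by (simp add: c_def)
  have "(\<lambda>t. correlation M (time_change N \<Gamma> t) (time_change N \<Gamma> s)) \<sim>[at_top] (\<lambda>t. c s * t powr (- d))"
    if s: "s > 0" for s
  proof (rule asymp_equivI')
    define c0 where "c0 = k s / (sqrt v * sqrt (V s))"
    have c0: "c0 > 0" using k(1)[OF s] v(1) V_pos[OF s] by (simp add: c0_def)
    have "((\<lambda>t. (C s t / (t / \<nu>) powr e) / (sqrt (V t / (t / \<nu>) powr p) * sqrt (V s)) / c0)
        \<longlongrightarrow> c0 / c0) at_top"
      unfolding c0_def using V_pos[OF s] v(1) k(1)[OF s]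
      by (intro tendsto_intros k(2)[OF s] v(2)) auto
    moreover have "\<forall>\<^sub>F t in at_top. (C s t / (t / \<nu>) powr e) / (sqrt (V t / (t / \<nu>) powr p) * sqrt (V s)) / c0 =
        correlation M (time_change N \<Gamma> t) (time_change N \<Gamma> s) / (c s * t powr (- d))"
      using eventually_gt_at_top[of s]
    proof eventually_elim
      case (elim t)
      have t: "t > 0" using s elim by simp
      then have x: "t / \<nu> > 0" using \<nu>_pos by simp
      have corr: "correlation M (time_change N \<Gamma> t) (time_change N \<Gamma> s) = C s t / (sqrt (V t) * sqrt (V s))"
        using changed_correlation[OF s elim] by (simp add: C_def V_def)
      have "sqrt ((t / \<nu>) powr p) = (t / \<nu>) powr (p / 2)"
        using x by (simp flip: powr_half_sqrt add: powr_powr)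
      \<comment> \<open>The choice of \<open>d\<close> makes the normalising powers of numerator and
        denominator cancel up to \<open>(t / \<nu>) powr d\<close>.\<close>
      moreover have "(t / \<nu>) powr (p / 2) = (t / \<nu>) powr e * (t / \<nu>) powr d"
        by (simp add: d_def flip: powr_add)
      moreover have "c s * t powr (- d) = c0 / (t / \<nu>) powr d"
        using t \<nu>_pos by (simp add: c_def c0_def powr_divide powr_minus_divide)
      ultimately show ?case
        using x by (simp add: corr real_sqrt_divide)
    qed
    ultimately have "((\<lambda>t. correlation M (time_change N \<Gamma> t) (time_change N \<Gamma> s) / (c s * t powr (- d)))
        \<longlongrightarrow> c0 / c0) at_top"
      by (rule Lim_transform_eventually)
    then show "((\<lambda>t. correlation M (time_change N \<Gamma> t) (time_change N \<Gamma> s) / (c s * t powr (- d))) \<longlongrightarrow> 1) at_top"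
      using c0 by simp
  qed
  then have "\<forall>s>0. c s \<noteq> 0 \<and>
      (\<lambda>t. correlation M (time_change N \<Gamma> t) (time_change N \<Gamma> s)) \<sim>[at_top] (\<lambda>t. c s * t powr (- d))"
    using c_pos by (auto dest: less_imp_neq[THEN not_sym] simp: less_le)
  then show ?thesis
    unfolding long_range_dependent_def using changed_measurable changed_square_integrable by blast
qed

theorem theorem3p1:
  fixes M :: "'a measure"
    and B1 B2 N \<Gamma> :: "real \<Rightarrow> 'a \<Rightarrow> real"
    and H1 H2 a b \<nu> :: real
  assumes "prob_space M"
    and "0 < H1" and "H1 < H2" and "H2 < 1"
    and "generalized_mixed_fbm M H1 H2 a b B1 B2 N"
    and "0 < \<nu>"
    and "gamma_process M \<nu> \<Gamma>"
    and "indep_processes M (\<lambda>t \<omega>. (B1 t \<omega>, B2 t \<omega>)) \<Gamma>"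
    and "2 * H1 - H2 < 1"
  shows "long_range_dependent M (time_change N \<Gamma>)"
proof -
  interpret prob_space M by fact
  interpret gamma_changed_fbm M H1 H2 a b B1 B2 N \<nu> \<Gamma>
    by unfold_locales fact+
  show ?thesis by (rule changed_long_range_dependent) fact
qed

end
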